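(* Let $G(V,E)$ be a hypergraph. Then $\chi^c(G)=\lceil \log_2 \chi(G)\rceil$.
   Context: Hypergraphs are finite, and each hyperedge is a subset of $V$ with at least two vertices. A bicoloring of $G$ is a map $X:V\to\{0,1\}$; a hyperedge $e$ is properly bicolored (non-monochromatic) by $X$ if $X$ is not constant on $e$. A bicoloring cover of $G$ is a set $\{X_1,\dots,X_t\}$ of bicolorings such that every hyperedge $e\in E$ is properly bicolored by at least one $X_i$. The bicoloring cover number $\chi^c(G)$ is the minimum size of a bicoloring cover of $G$. The chromatic number $\chi(G)$ is the minimum number of colors in a vertex coloring of $G$ under which no hyperedge is monochromatic. *)

theory Defs
  imports "HOL-Analysis.Analysis"
begin

locale hypergraph =
  fixes V :: "'a set" and E :: "'a set set"
  assumes finite_vertices: "finite V"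
    and edge_subset: "e \<in> E \<Longrightarrow> e \<subseteq> V"
    and card_edge_ge_2: "e \<in> E \<Longrightarrow> 2 \<le> card e"

(* Maps on V are extensional functions, so that distinct elements of a cover
   really are distinct maps on V. *)
definition bicolorings :: "'a set \<Rightarrow> ('a \<Rightarrow> nat) set" where
  "bicolorings V = V \<rightarrow>\<^sub>E {0, 1}"

definition non_monochromatic :: "('a \<Rightarrow> 'b) \<Rightarrow> 'a set \<Rightarrow> bool" where
  "non_monochromatic f e \<longleftrightarrow> \<not> f constant_on e"

definition bicoloring_cover :: "'a set \<Rightarrow> 'a set set \<Rightarrow> ('a \<Rightarrow> nat) set \<Rightarrow> bool" where
  "bicoloring_cover V E C \<longleftrightarrow>
     finite C \<and> C \<subseteq> bicolorings V \<and> (\<forall>e\<in>E. \<exists>X\<in>C. non_monochromatic X e)"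

definition bicoloring_cover_number :: "'a set \<Rightarrow> 'a set set \<Rightarrow> nat" where
  "bicoloring_cover_number V E = (LEAST t. \<exists>C. bicoloring_cover V E C \<and> card C = t)"

definition proper_coloring :: "'a set \<Rightarrow> 'a set set \<Rightarrow> nat \<Rightarrow> ('a \<Rightarrow> nat) \<Rightarrow> bool" where
  "proper_coloring V E k c \<longleftrightarrow> c \<in> V \<rightarrow>\<^sub>E {..<k} \<and> (\<forall>e\<in>E. non_monochromatic c e)"

definition chromatic_number :: "'a set \<Rightarrow> 'a set set \<Rightarrow> nat" where
  "chromatic_number V E = (LEAST k. \<exists>c. proper_coloring V E k c)"

end

(* A bicoloring cover of size t gives every vertex a vector of t bits, and an edge is properly
   bicolored by some member of the cover iff its vertices do not all get the same vector.
   So covers with at most t members and proper colorings with at most 2^t colors are two views of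
   the same object, whence the cover number is at most t iff the chromatic number is at
   most 2^t. *)
theory Submission
  imports Defs
begin

lemma non_monochromatic_iff: "non_monochromatic f e \<longleftrightarrow> (\<exists>u\<in>e. \<exists>v\<in>e. f u \<noteq> f v)"
  unfolding non_monochromatic_def constant_on_def by metis

lemma proper_coloring_mono:
  assumes "proper_coloring V E k c" "k \<le> l"
  shows "proper_coloring V E l c"
  using assms unfolding proper_coloring_def by (auto simp: PiE_iff intro: less_le_trans)

text \<open>The colors are the bit vectors indexed by \<open>C\<close>, numbered by a bijection
  \<open>h\<close>. An edge that some \<open>X\<close> in \<open>C\<close> splits has two vertices
  whose vectors differ at coordinate \<open>X\<close>.\<close>

lemma proper_coloring_of_cover:
  assumes edges: "\<And>e. e \<in> E \<Longrightarrow> e \<subseteq> V" and cover: "bicoloring_cover V E C"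
  shows "\<exists>c. proper_coloring V E (2 ^ card C) c"
proof -
  let ?M = "C \<rightarrow>\<^sub>E {0, 1::nat}"
  \<comment> \<open>Restricting to \<open>C\<close> puts \<open>b v\<close> into the extensional
    space \<open>?M\<close>, which has exactly \<open>2 ^ card C\<close> elements.\<close>
  define b where "b v = (\<lambda>X\<in>C. X v)" for v
  have C: "finite C" "C \<subseteq> bicolorings V" "\<And>e. e \<in> E \<Longrightarrow> \<exists>X\<in>C. non_monochromatic X e"
    using cover by (auto simp: bicoloring_cover_def)
  have "finite ?M" "card ?M = 2 ^ card C"
    using C(1) by (auto simp: card_PiE numeral_2_eq_2 intro: finite_PiE)
  then obtain h where h: "bij_betw h ?M {0..<2 ^ card C :: nat}"
    using ex_bij_betw_finite_nat[of ?M] by auto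
  have b_mem: "b v \<in> ?M" if "v \<in> V" for v
    using C(2) that unfolding b_def bicolorings_def restrict_PiE_iff by (blast dest: PiE_mem)
  have "proper_coloring V E (2 ^ card C) (\<lambda>v\<in>V. h (b v))"
    unfolding proper_coloring_def
  proof (intro conjI ballI)
    show "(\<lambda>v\<in>V. h (b v)) \<in> V \<rightarrow>\<^sub>E {..<2 ^ card C}"
      using bij_betwE[OF h] b_mem by auto
  next
    fix e assume e: "e \<in> E"
    from C(3)[OF e] obtain X u v where X: "X \<in> C" "u \<in> e" "v \<in> e" "X u \<noteq> X v"
      unfolding non_monochromatic_iff by blast
    have uv: "u \<in> V" "v \<in> V" using X edges[OF e] by auto
    have "b u X \<noteq> b v X" using X by (simp add: b_def)
    hence "h (b u) \<noteq> h (b v)"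
      using bij_betw_imp_inj_on[OF h] b_mem uv by (metis inj_on_eq_iff)
    then show "non_monochromatic (\<lambda>v\<in>V. h (b v)) e"
      unfolding non_monochromatic_iff using X uv by (metis restrict_apply')
  qed
  then show ?thesis by blast
qed

text \<open>Colors are coded as subsets of \<open>{..<t}\<close>, and each index gives one
  bicoloring. Different indices may give the same bicoloring, so the cover has at most
  \<open>t\<close> members rather than exactly \<open>t\<close>.\<close>

lemma cover_of_proper_coloring:
  assumes edges: "\<And>e. e \<in> E \<Longrightarrow> e \<subseteq> V" and coloring: "proper_coloring V E (2 ^ t) c"
  shows "\<exists>C. bicoloring_cover V E C \<and> card C \<le> t"
proof -
  obtain h where "bij_betw h (Pow {..<t}) {0..<2 ^ t :: nat}"
    using ex_bij_betw_finite_nat[of "Pow {..<t}"] by (auto simp: card_Pow)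
  then obtain g where g: "bij_betw g {0..<2 ^ t :: nat} (Pow {..<t})"
    by (metis bij_betw_inv)
  \<comment> \<open>\<open>X i\<close> reads off bit \<open>i\<close> of the color of
    \<open>v\<close>: whether \<open>i\<close> belongs to the subset that codes
    \<open>c v\<close>.\<close>
  define X where "X i = (\<lambda>v\<in>V. if i \<in> g (c v) then 1 else (0::nat))" for i
  have c: "c v \<in> {0..<2 ^ t}" if "v \<in> V" for v
    using coloring that by (auto simp: proper_coloring_def dest: PiE_mem)
  have "bicoloring_cover V E (X ` {..<t})"
    unfolding bicoloring_cover_def
  proof (intro conjI ballI)
    show "X ` {..<t} \<subseteq> bicolorings V"
      by (auto simp: X_def bicolorings_def split: if_splits)
  next
    fix e assume e: "e \<in> E"
    then obtain u v where uv: "u \<in> e" "v \<in> e" "c u \<noteq> c v"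
      using coloring unfolding proper_coloring_def non_monochromatic_iff by blast
    have V: "u \<in> V" "v \<in> V" using uv edges[OF e] by auto
    have "g (c u) \<noteq> g (c v)"
      using bij_betw_imp_inj_on[OF g] c V uv(3) by (metis inj_on_eq_iff)
    moreover have "g (c u) \<subseteq> {..<t}" "g (c v) \<subseteq> {..<t}"
      using bij_betwE[OF g] c V by auto
    ultimately obtain i where i: "i < t" "(i \<in> g (c u)) \<noteq> (i \<in> g (c v))"
      by blast
    then have "X i u \<noteq> X i v" using V by (auto simp: X_def)
    then show "\<exists>Y\<in>X ` {..<t}. non_monochromatic Y e"
      unfolding non_monochromatic_iff using uv i(1) by blast
  qed simp
  moreover have "card (X ` {..<t}) \<le> t"
    using card_image_le[of "{..<t}" X] by simp
  ultimately show ?thesis by blast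
qed

context hypergraph
begin

text \<open>Giving all vertices different colors works because every edge has two distinct vertices.
  Hence the minimum defining the chromatic number is attained.\<close>

lemma proper_coloring_exists: "\<exists>k c. proper_coloring V E k c"
proof -
  obtain h where h: "bij_betw h V {0..<card V}"
    using ex_bij_betw_finite_nat[OF finite_vertices] by blast
  have "proper_coloring V E (card V) (restrict h V)"
    unfolding proper_coloring_def
  proof (intro conjI ballI)
    show "restrict h V \<in> V \<rightarrow>\<^sub>E {..<card V}"
      using bij_betwE[OF h] by auto
  next
    fix e assume e: "e \<in> E"
    have "\<not> is_singleton e" "e \<noteq> {}"
      using card_edge_ge_2[OF e] by (auto simp: is_singleton_altdef)
    then obtain u v where uv: "u \<in> e" "v \<in> e" "u \<noteq> v"
      by (metis is_singletonI' all_not_in_conv)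
    moreover have "u \<in> V" "v \<in> V" using uv edge_subset[OF e] by auto
    ultimately show "non_monochromatic (restrict h V) e"
      unfolding non_monochromatic_iff using bij_betw_imp_inj_on[OF h]
      by (metis inj_on_eq_iff restrict_apply')
  qed
  then show ?thesis by blast
qed

lemma chromatic_number_le_iff:
  "chromatic_number V E \<le> k \<longleftrightarrow> (\<exists>c. proper_coloring V E k c)"
proof
  assume "chromatic_number V E \<le> k"
  moreover have "\<exists>c. proper_coloring V E (chromatic_number V E) c"
    unfolding chromatic_number_def using proper_coloring_exists by (rule LeastI_ex)
  ultimately show "\<exists>c. proper_coloring V E k c"
    using proper_coloring_mono by blast
next
  assume "\<exists>c. proper_coloring V E k c"
  then show "chromatic_number V E \<le> k"
    unfolding chromatic_number_def by (rule Least_le)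
qed

lemma bicoloring_cover_number_le_iff:
  "bicoloring_cover_number V E \<le> t \<longleftrightarrow> chromatic_number V E \<le> 2 ^ t"
proof
  \<comment> \<open>Some cover must exist before its least size can be used. Since
    \<open>k \<le> 2 ^ k\<close>, any proper coloring with \<open>k\<close> colors yields
    one.\<close>
  obtain k c where "proper_coloring V E k c"
    using proper_coloring_exists by blast
  then have "proper_coloring V E (2 ^ k) c"
    by (rule proper_coloring_mono) simp
  then have "\<exists>t C. bicoloring_cover V E C \<and> card C = t"
    using cover_of_proper_coloring[OF edge_subset] by blast
  then have "\<exists>C. bicoloring_cover V E C \<and> card C = bicoloring_cover_number V E"
    unfolding bicoloring_cover_number_def by (rule LeastI_ex)
  then have "chromatic_number V E \<le> 2 ^ bicoloring_cover_number V E"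
    unfolding chromatic_number_le_iff using proper_coloring_of_cover[OF edge_subset] by metis
  moreover assume "bicoloring_cover_number V E \<le> t"
  ultimately show "chromatic_number V E \<le> 2 ^ t"
    by (meson le_trans one_le_numeral power_increasing)
next
  assume "chromatic_number V E \<le> 2 ^ t"
  then obtain C where C: "bicoloring_cover V E C" "card C \<le> t"
    unfolding chromatic_number_le_iff using cover_of_proper_coloring[OF edge_subset] by blast
  then have "bicoloring_cover_number V E \<le> card C"
    unfolding bicoloring_cover_number_def by (intro Least_le) blast
  then show "bicoloring_cover_number V E \<le> t" using C(2) by simp
qed

end

theorem theorem1:
  fixes V :: "'a set" and E :: "'a set set"
  assumes "hypergraph V E"
  shows "int (bicoloring_cover_number V E) = \<lceil>log 2 (real (chromatic_number V E))\<rceil>"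
proof -
  define n k where "n = bicoloring_cover_number V E" and "k = chromatic_number V E"
  \<comment> \<open>This equivalence for all \<open>t\<close> makes \<open>n\<close> the least
    exponent with \<open>k \<le> 2 ^ n\<close>, so only arithmetic remains.\<close>
  have iff: "n \<le> t \<longleftrightarrow> k \<le> 2 ^ t" for t
    unfolding n_def k_def by (rule hypergraph.bicoloring_cover_number_le_iff[OF assms])
  have "int n = \<lceil>log 2 (real k)\<rceil>"
  proof (cases n)
    case 0
    \<comment> \<open>An empty vertex set gives \<open>k = 0\<close>, where \<open>log 2 0 = 0\<close> by convention.\<close>
    then have "k = 0 \<or> k = 1" using iff[of 0] by auto
    then show ?thesis using 0 by (auto simp: log_def)
  next
    case (Suc m)
    \<comment> \<open>As \<open>n \<le> m\<close> fails, \<open>k\<close> lies strictly above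
      \<open>2 ^ m\<close> and at most at \<open>2 ^ (m + 1)\<close>, which fixes the ceiling as
      \<open>m + 1\<close>.\<close>
    have "2 ^ m < k" using iff[of m] Suc by simp
    moreover have "k \<le> 2 ^ n" using iff by blast
    ultimately show ?thesis
      using ceiling_log_nat_eq_if[of 2 m k] Suc by simp
  qed
  then show ?thesis by (simp add: n_def k_def)
qed

end
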